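(* Let $\mathcal{C}(t,x)=\sum_{n=0}^\infty\psi_{C_n}(t)x^n$ (with $\psi_{C_0}(t)=1$ by convention) and $\mathcal{S}(t,x)=\sum_{n=0}^\infty\psi_{S_n}(t)\frac{x^n}{n!}$. Then, as formal power series in $x$ over $\mathbb{Q}[t]$: (a) $\mathcal{C}(t,x)=\exp(t\ln(1+x))=(1+x)^t$, or in other words $\psi_{C_n}(t)=\binom{t}{n}=\frac{t(t-1)\cdots(t-n+1)}{n!}$; (b) $\mathcal{S}(t,x)=\dfrac{e^{xt}-1}{e^x-1}$.
   Context: A rooted tree is a finite connected acyclic graph with a designated root $\mathrm{rt}_T$; isomorphisms preserve roots. $E(T)$ is the edge set and $v(T)$ the number of vertices. $C_n$ ($n\ge1$) is the chain: the rooted tree with $n$ vertices and height $n-1$. $S_n$ ($n\ge 0$) is the shrub: the rooted tree with $n+1$ vertices in which every non-root vertex is a child of the root. For $e\in E(T)$ let $T_e$ be the component of $T$ minus the edge $e$ containing $\mathrm{rt}_T$ (rooted at $\mathrm{rt}_T$), and $T'_e$ the other component, rooted at the endpoint of $e$ farther from $\mathrm{rt}_T$. Write $e\succ f$ if $f\in E(T_e)$; $e_1\succ\cdots\succ e_r$ means $e_i\succ e_j$ for all $i<j$. Such a sequence $\vec e$ determines rooted trees $T_{\vec e,1},\ldots,T_{\vec e,r+1}$: put $S^{(1)}=T$ and, for $i=1,\ldots,r$, $T_{\vec e,i}=(S^{(i)})'_{e_i}$, $S^{(i+1)}=(S^{(i)})_{e_i}$; finally $T_{\vec e,r+1}=S^{(r+1)}$.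 The numbers $\phi_T\in\mathbb{Q}$ are defined recursively by $\phi_T=1$ if $v(T)=1$ and, for $v(T)\ge2$, $\phi_T=-\sum_{k=2}^{v(T)}\frac{1}{k!}\sum_{\vec e\in E(T)^{k-1},\,e_1\succ\cdots\succ e_{k-1}}\phi_{T_{\vec e,1}}\cdots\phi_{T_{\vec e,k}}$. The polynomials $\psi_T(t)\in\mathbb{Q}[t]$ are $$\psi_T(t)=\sum_{k=1}^{v(T)}\frac{t^k}{k!}\sum_{\substack{\vec e\in E(T)^{k-1}\\ e_1\succ\cdots\succ e_{k-1}}}\phi_{T_{\vec e,1}}\cdots\phi_{T_{\vec e,k}},$$ where the inner sum for $k=1$ is $\phi_T$. *)

theory Defs
  imports "HOL-Computational_Algebra.Computational_Algebra"
begin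

section \<open>Rooted trees\<close>

datatype 'a rgraph = RGraph (verts: "'a set") (edges: "'a set set") (root: 'a)

definition adj :: "'a set set \<Rightarrow> ('a \<times> 'a) set" where
  "adj F = {(u, v). {u, v} \<in> F}"

definition is_cycle :: "'a set set \<Rightarrow> 'a list \<Rightarrow> bool" where
  "is_cycle F p \<longleftrightarrow> 3 \<le> length p \<and> distinct p \<and>
     (\<forall>i<length p. {p ! i, p ! (Suc i mod length p)} \<in> F)"

definition rooted_tree :: "'a rgraph \<Rightarrow> bool" where
  "rooted_tree T \<longleftrightarrow>
     finite (verts T) \<and> root T \<in> verts T \<and>
     (\<forall>e\<in>edges T. e \<subseteq> verts T \<and> card e = 2) \<and>
     (\<forall>u\<in>verts T. \<forall>v\<in>verts T. (u, v) \<in> (adj (edges T))\<^sup>*) \<and>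
     (\<nexists>p. is_cycle (edges T) p)"

text \<open>The distance of \<open>v\<close> from the root.\<close>

definition depth :: "'a rgraph \<Rightarrow> 'a \<Rightarrow> nat" where
  "depth T v = (LEAST n. (root T, v) \<in> adj (edges T) ^^ n)"

definition height :: "'a rgraph \<Rightarrow> nat" where
  "height T = Max (depth T ` verts T)"

definition is_chain :: "nat \<Rightarrow> 'a rgraph \<Rightarrow> bool" where
  "is_chain n T \<longleftrightarrow> rooted_tree T \<and> card (verts T) = n \<and> height T = n - 1"

definition is_shrub :: "nat \<Rightarrow> 'a rgraph \<Rightarrow> bool" where
  "is_shrub n T \<longleftrightarrow> rooted_tree T \<and> card (verts T) = n + 1 \<and>
     (\<forall>v\<in>verts T - {root T}. {root T, v} \<in> edges T)"


section \<open>Cutting edges\<close>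

text \<open>The connected component of \<open>r\<close> in \<open>T\<close> minus the edge \<open>e\<close>, rooted at \<open>r\<close>.\<close>

definition component :: "'a rgraph \<Rightarrow> 'a set \<Rightarrow> 'a \<Rightarrow> 'a rgraph" where
  "component T e r =
     (let V = {v \<in> verts T. (r, v) \<in> (adj (edges T - {e}))\<^sup>*}
      in RGraph V {f \<in> edges T - {e}. f \<subseteq> V} r)"

definition far_end :: "'a rgraph \<Rightarrow> 'a set \<Rightarrow> 'a" where
  "far_end T e = (THE v. v \<in> e \<and> (\<forall>u\<in>e - {v}. depth T u < depth T v))"

text \<open>\<open>cut_root T e\<close> is $T_e$ and \<open>cut_off T e\<close> is $T'_e$.\<close>

definition cut_root :: "'a rgraph \<Rightarrow> 'a set \<Rightarrow> 'a rgraph" where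
  "cut_root T e = component T e (root T)"

definition cut_off :: "'a rgraph \<Rightarrow> 'a set \<Rightarrow> 'a rgraph" where
  "cut_off T e = component T e (far_end T e)"

text \<open>\<open>edge_succ T e f\<close> is $e \succ f$.\<close>

definition edge_succ :: "'a rgraph \<Rightarrow> 'a set \<Rightarrow> 'a set \<Rightarrow> bool" where
  "edge_succ T e f \<longleftrightarrow> f \<in> edges (cut_root T e)"

definition edge_seqs :: "'a rgraph \<Rightarrow> nat \<Rightarrow> 'a set list set" where
  "edge_seqs T r = {es. length es = r \<and> set es \<subseteq> edges T \<and> sorted_wrt (edge_succ T) es}"

text \<open>The list $T_{\vec e,1}, \ldots, T_{\vec e,r+1}$.\<close>

fun pieces :: "'a rgraph \<Rightarrow> 'a set list \<Rightarrow> 'a rgraph list" where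
  "pieces T [] = [T]"
| "pieces T (e # es) = cut_off T e # pieces (cut_root T e) es"


section \<open>Facts needed for the recursion defining \<open>phi\<close>\<close>

lemma adj_sym: "(u, v) \<in> adj F \<Longrightarrow> (v, u) \<in> adj F"
  by (simp add: adj_def insert_commute)

lemma adj_rtrancl_sym: "(u, v) \<in> (adj F)\<^sup>* \<Longrightarrow> (v, u) \<in> (adj F)\<^sup>*"
  by (meson adj_sym symI sym_rtrancl symD)

lemma shortest_path:
  assumes "(u, v) \<in> R\<^sup>*" and "n = (LEAST n. (u, v) \<in> R ^^ n)"
  obtains f where "f 0 = u" "f n = v" "\<And>i. i < n \<Longrightarrow> (f i, f (Suc i)) \<in> R" "inj_on f {..n}"
proof -
  have "(u, v) \<in> R ^^ n"
    using assms by (metis LeastI rtrancl_power)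
  then obtain f where f: "f 0 = u" "f n = v" "\<forall>i<n. (f i, f (Suc i)) \<in> R"
    by (auto simp: relpow_fun_conv)
  have "f i \<noteq> f j" if "i < j" "j \<le> n" for i j
  proof
    assume eq: "f i = f j"
    have "(u, f i) \<in> R ^^ i"
      unfolding relpow_fun_conv using f that by (intro exI[of _ f]) auto
    moreover have "(f j, v) \<in> R ^^ (n - j)"
      unfolding relpow_fun_conv using f that by (intro exI[of _ "\<lambda>k. f (j + k)"]) auto
    ultimately have "(u, v) \<in> R ^^ (i + (n - j))"
      using eq by (auto simp: relpow_add)
    then have "n \<le> i + (n - j)"
      unfolding assms(2) by (rule Least_le)
    with that show False by linarith
  qed
  then have "inj_on f {..n}"
    by (intro linorder_inj_onI) auto
  with f show thesis using that by blast
qed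

lemma bridge:
  assumes "\<nexists>p. is_cycle F p" "{u, v} \<in> F" "u \<noteq> v"
  shows "(u, v) \<notin> (adj (F - {{u, v}}))\<^sup>*"
proof
  let ?R = "adj (F - {{u, v}})"
  assume uv: "(u, v) \<in> ?R\<^sup>*"
  define n where "n = (LEAST n. (u, v) \<in> ?R ^^ n)"
  obtain f where f: "f 0 = u" "f n = v" "\<And>i. i < n \<Longrightarrow> (f i, f (Suc i)) \<in> ?R"
    and inj: "inj_on f {..n}"
    using shortest_path[OF uv n_def] by metis
  have "n \<noteq> 0" using f assms(3) by (metis)
  moreover have "n \<noteq> 1"
  proof
    assume "n = 1"
    then have "(u, v) \<in> ?R" using f(1,2) f(3)[of 0] by auto
    then show False by (simp add: adj_def)
  qed
  ultimately have n: "2 \<le> n" by linarith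
  have "is_cycle F (map f [0..<Suc n])"
    unfolding is_cycle_def
  proof (intro conjI allI impI)
    show "3 \<le> length (map f [0..<Suc n])" using n by simp
    show "distinct (map f [0..<Suc n])"
      using inj by (simp add: distinct_map atLeast0_lessThan_Suc lessThan_Suc_atMost[symmetric]
          atLeast0LessThan lessThan_Suc)
    fix i assume i: "i < length (map f [0..<Suc n])"
    show "{map f [0..<Suc n] ! i, map f [0..<Suc n] ! (Suc i mod length (map f [0..<Suc n]))} \<in> F"
    proof (cases "i = n")
      case True
      then show ?thesis using f assms(2) by (simp add: insert_commute del: upt_Suc)
    next
      case False
      then have "i < n" using i by simp
      then show ?thesis using f(3)[of i] by (simp add: adj_def del: upt_Suc)
    qed
  qed
  with assms(1) show False by blast
qed

lemma near_end_reachable: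
  assumes "rooted_tree T" "{u, v} \<in> edges T" "depth T u \<le> depth T v"
  shows "(root T, u) \<in> (adj (edges T - {{u, v}}))\<^sup>*"
proof -
  have "u \<in> verts T" using assms by (auto simp: rooted_tree_def)
  then have ru: "(root T, u) \<in> (adj (edges T))\<^sup>*"
    using assms by (auto simp: rooted_tree_def)
  obtain f where f: "f 0 = root T" "f (depth T u) = u"
    "\<And>i. i < depth T u \<Longrightarrow> (f i, f (Suc i)) \<in> adj (edges T)"
    using shortest_path[OF ru depth_def] by metis
  have "(f i, f (Suc i)) \<in> adj (edges T - {{u, v}})" if i: "i < depth T u" for i
  proof -
    have "(root T, f i) \<in> adj (edges T) ^^ i"
      unfolding relpow_fun_conv using f i by (intro exI[of _ f]) auto
    then have "depth T (f i) \<le> i"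
      unfolding depth_def by (rule Least_le)
    then have "f i \<noteq> u" "f i \<noteq> v" using i assms(3) by auto
    then have "{f i, f (Suc i)} \<noteq> {u, v}" by (auto simp: doubleton_eq_iff)
    then show ?thesis using f(3)[OF i] by (auto simp: adj_def)
  qed
  then have "(root T, u) \<in> adj (edges T - {{u, v}}) ^^ depth T u"
    unfolding relpow_fun_conv using f by (intro exI[of _ f]) auto
  then show ?thesis by (rule relpow_imp_rtrancl)
qed

lemma edge_ends:
  assumes T: "rooted_tree T" and e: "e \<in> edges T"
  obtains u v where "e = {u, v}" "depth T u < depth T v" "far_end T e = v"
    "(root T, u) \<in> (adj (edges T - {e}))\<^sup>*" "(root T, v) \<notin> (adj (edges T - {e}))\<^sup>*"
proof -
  have "card e = 2" using T e by (auto simp: rooted_tree_def)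
  then obtain a b where ab: "e = {a, b}" "a \<noteq> b" by (auto simp: card_2_iff)
  define u v where "u = (if depth T a \<le> depth T b then a else b)"
    and "v = (if depth T a \<le> depth T b then b else a)"
  have uv: "e = {u, v}" "u \<noteq> v" "depth T u \<le> depth T v"
    using ab by (auto simp: u_def v_def)
  have ru: "(root T, u) \<in> (adj (edges T - {e}))\<^sup>*"
    using near_end_reachable[OF T, of u v] e uv by simp
  have nuv: "(u, v) \<notin> (adj (edges T - {e}))\<^sup>*"
    using bridge[of "edges T" u v] T e uv by (simp add: rooted_tree_def)
  have rv: "(root T, v) \<notin> (adj (edges T - {e}))\<^sup>*"
    using ru nuv adj_rtrancl_sym rtrancl_trans by metis
  have "depth T u \<noteq> depth T v"
  proof
    assume "depth T u = depth T v"
    then have "(root T, v) \<in> (adj (edges T - {e}))\<^sup>*"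
      using near_end_reachable[OF T, of v u] e uv by (simp add: insert_commute)
    with rv show False by blast
  qed
  with uv have less: "depth T u < depth T v" by simp
  have "far_end T e = v"
    unfolding far_end_def using uv less by (intro the_equality) auto
  with uv less ru rv that show thesis by blast
qed

lemma verts_cut_subset:
  "verts (cut_root T e) \<subseteq> verts T" "verts (cut_off T e) \<subseteq> verts T"
  by (auto simp: cut_root_def cut_off_def component_def Let_def)

lemma verts_cut_psubset:
  assumes T: "rooted_tree T" and e: "e \<in> edges T"
  shows "verts (cut_root T e) \<subset> verts T" "verts (cut_off T e) \<subset> verts T"
proof -
  from edge_ends[OF T e] obtain u v where uv: "e = {u, v}" "far_end T e = v"
    "(root T, v) \<notin> (adj (edges T - {e}))\<^sup>*" by metis
  have "v \<in> verts T" "root T \<in> verts T"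
    using T e uv by (auto simp: rooted_tree_def)
  moreover have "v \<notin> verts (cut_root T e)"
    using uv by (auto simp: cut_root_def component_def Let_def)
  moreover have "root T \<notin> verts (cut_off T e)"
    using uv adj_rtrancl_sym[of v "root T" "edges T - {e}"]
    by (auto simp: cut_off_def component_def Let_def)
  ultimately show "verts (cut_root T e) \<subset> verts T" "verts (cut_off T e) \<subset> verts T"
    using verts_cut_subset[of T e] by blast+
qed

lemma verts_pieces_subset: "S \<in> set (pieces T es) \<Longrightarrow> verts S \<subseteq> verts T"
  using verts_cut_subset by (induction T es rule: pieces.induct) fastforce+

lemma card_verts_pieces_less:
  assumes T: "rooted_tree T" and es: "es \<in> edge_seqs T r" "1 \<le> r"
    and S: "S \<in> set (pieces T es)"
  shows "card (verts S) < card (verts T)"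
proof -
  from es obtain e es' where [simp]: "es = e # es'" and e: "e \<in> edges T"
    by (cases es) (auto simp: edge_seqs_def)
  have "verts S \<subset> verts T"
    using S verts_cut_psubset[OF T e] verts_pieces_subset[of S "cut_root T e" es'] by auto
  then show ?thesis
    using T by (intro psubset_card_mono) (auto simp: rooted_tree_def)
qed


section \<open>The numbers \<open>phi\<close> and the polynomials \<open>psi\<close>\<close>

text \<open>The value outside rooted trees is a dummy that makes the recursion terminate.\<close>

function phi :: "'a rgraph \<Rightarrow> rat" where
  "phi T =
     (if \<not> rooted_tree T then 0
      else if card (verts T) = 1 then 1
      else - (\<Sum>k=2..card (verts T). 1 / fact k *
               (\<Sum>es\<in>edge_seqs T (k - 1). prod_list (map phi (pieces T es)))))"
  by auto
termination
proof (relation "measure (\<lambda>T. card (verts T))", goal_cases)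
  case 1
  show ?case by simp
next
  case (2 T k es S)
  then have "1 \<le> k - 1" by auto
  with 2 show ?case
    using card_verts_pieces_less[of T es "k - 1" S] by simp
qed

declare phi.simps [simp del]

definition psi :: "'a rgraph \<Rightarrow> rat poly" where
  "psi T = (\<Sum>k=1..card (verts T). monom
     (1 / fact k * (\<Sum>es\<in>edge_seqs T (k - 1). prod_list (map phi (pieces T es)))) k)"


section \<open>Chains and shrubs exist\<close>

text \<open>The tree on \<open>{0..<n}\<close> in which the parent of \<open>v > 0\<close> is \<open>p v < v\<close>.\<close>

definition parent_tree :: "nat \<Rightarrow> (nat \<Rightarrow> nat) \<Rightarrow> nat rgraph" where
  "parent_tree n p = RGraph {0..<n} {{p v, v} |v. 0 < v \<and> v < n} 0"

lemma rooted_tree_parent_tree: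
  assumes n: "1 \<le> n" and p: "\<And>v. 0 < v \<Longrightarrow> p v < v"
  shows "rooted_tree (parent_tree n p)"
proof -
  define F where "F = {{p v, v} |v. 0 < v \<and> v < n}"
  have up: "(0, v) \<in> (adj F)\<^sup>*" if "v < n" for v
    using that
  proof (induction v rule: less_induct)
    case (less v)
    show ?case
    proof (cases "v = 0")
      case False
      then have "(0, p v) \<in> (adj F)\<^sup>*" using less p[of v] by auto
      moreover have "(p v, v) \<in> adj F" using False less.prems by (auto simp: adj_def F_def)
      ultimately show ?thesis by (rule rtrancl_into_rtrancl)
    qed simp
  qed
  have "(u, v) \<in> (adj F)\<^sup>*" if "u < n" "v < n" for u v
    using up[OF that(1)] up[OF that(2)] adj_rtrancl_sym rtrancl_trans by metis
  moreover have "\<not> is_cycle F c" for c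
  proof
    assume c: "is_cycle F c"
    define l where "l = length c"
    have l: "3 \<le> l" and dist: "distinct c"
      and edge: "\<And>i. i < l \<Longrightarrow> {c ! i, c ! (Suc i mod l)} \<in> F"
      using c by (auto simp: is_cycle_def l_def)
    have par: "x = p m" if "{x, m} \<in> F" "x \<le> m" for x m
    proof -
      from that(1) obtain v where v: "{x, m} = {p v, v}" "0 < v" by (auto simp: F_def)
      then have "p v < v" using p by blast
      with v(1) that(2) show ?thesis by (auto simp: doubleton_eq_iff)
    qed
    have "Max (set c) \<in> set c" using l by (intro Max_in) (auto simp: l_def)
    then obtain j where j: "j < l" "c ! j = Max (set c)"
      by (auto simp: in_set_conv_nth l_def)
    define i where "i = (if j = 0 then l - 1 else j - 1)"
    have i: "i < l" "Suc i mod l = j" "Suc j mod l < l" "Suc j mod l \<noteq> i"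
      using j l by (auto simp: i_def mod_Suc)
    have le: "c ! k \<le> c ! j" if "k < l" for k
      using that j by (simp add: l_def)
    have "c ! i = p (c ! j)"
      using par edge[OF i(1)] le[OF i(1)] i by simp
    moreover have "c ! (Suc j mod l) = p (c ! j)"
      using par edge[OF j(1)] le[OF i(3)] by (simp add: insert_commute)
    ultimately show False
      using dist i by (metis l_def nth_eq_iff_index_eq)
  qed
  moreover have "e \<subseteq> {0..<n} \<and> card e = 2" if "e \<in> F" for e
  proof -
    from that obtain v where "e = {p v, v}" "0 < v" "v < n" by (auto simp: F_def)
    with p[of v] show ?thesis by auto
  qed
  ultimately show ?thesis
    using n by (auto simp: rooted_tree_def parent_tree_def F_def[symmetric])
qed

lemma is_shrub_parent_tree: "is_shrub n (parent_tree (n + 1) (\<lambda>_. 0))"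
  using rooted_tree_parent_tree[of "n + 1" "\<lambda>_. 0"]
  by (auto simp: is_shrub_def parent_tree_def)

lemma is_chain_parent_tree:
  assumes "1 \<le> n"
  shows "is_chain n (parent_tree n (\<lambda>v. v - 1))"
proof -
  define T where "T = parent_tree n (\<lambda>v. v - 1)"
  have step: "b \<le> Suc a" if "(a, b) \<in> adj (edges T)" for a b
    using that by (auto simp: T_def parent_tree_def adj_def doubleton_eq_iff)
  have lower: "b \<le> k" if "(0, b) \<in> adj (edges T) ^^ k" for b k
    using that
  proof (induction k arbitrary: b)
    case (Suc k)
    then obtain a where "(0, a) \<in> adj (edges T) ^^ k" "(a, b) \<in> adj (edges T)" by auto
    with Suc.IH[of a] step[of a b] show ?case by simp
  qed simp
  have upper: "(0, b) \<in> adj (edges T) ^^ b" if "b < n" for b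
    using that
  proof (induction b)
    case (Suc b)
    have "{b, Suc b} \<in> edges T"
      using Suc.prems by (auto simp: T_def parent_tree_def intro!: exI[of _ "Suc b"])
    with Suc show ?case by (auto simp: adj_def)
  qed simp
  have "root T = 0" by (simp add: T_def parent_tree_def)
  then have "depth T b = b" if "b < n" for b
    unfolding depth_def using lower upper[OF that] by (auto intro!: Least_equality)
  then have "depth T ` verts T = {0..<n}" by (force simp: T_def parent_tree_def)
  moreover have "Max {0..<n} = n - 1" using assms by (intro Max_eqI) auto
  ultimately have "height T = n - 1" by (simp add: height_def)
  moreover have "rooted_tree T"
    unfolding T_def using assms by (intro rooted_tree_parent_tree) auto
  ultimately show ?thesis
    by (simp add: is_chain_def T_def parent_tree_def)
qed


section \<open>The generating series\<close>

text \<open>Power series in \<open>x\<close> over $\mathbb{Q}[t]$ are of type \<^typ>\<open>rat poly fps\<close>: \<open>tvar\<close> is \<open>t\<close>, and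
  the fps variable is \<open>x\<close>.  The library's \<^const>\<open>fps_exp\<close> and \<^const>\<open>fps_ln\<close> require coefficients
  in a field, so they are taken over $\mathbb{Q}$ and then mapped into $\mathbb{Q}[t][[x]]$.\<close>

abbreviation tvar :: "rat poly" where
  "tvar \<equiv> [:0, 1:]"

definition fps_lift :: "rat fps \<Rightarrow> rat poly fps" where
  "fps_lift f = Abs_fps (\<lambda>n. [:fps_nth f n:])"

text \<open>\<open>exp(f)\<close>, for \<open>f\<close> with constant coefficient 0.\<close>

definition fps_Exp :: "rat poly fps \<Rightarrow> rat poly fps" where
  "fps_Exp f = fps_compose (fps_lift (fps_exp 1)) f"

text \<open>The quotient $(e^{xt} - 1)/(e^x - 1)$ is to be taken in the field of fractions (\<^const>\<open>Fract\<close>)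
  of $\mathbb{Q}[t][[x]]$, because \<open>e\<^sup>x - 1\<close> is not a unit; it is nonzero by
  \<open>fps_Exp_X_minus_1_nonzero\<close> below.\<close>

text \<open>The series \<open>ln(1 + x)\<close>.\<close>

definition fps_ln1p :: "rat poly fps" where
  "fps_ln1p = fps_lift (fps_ln 1)"

definition binom_poly :: "rat poly \<Rightarrow> nat \<Rightarrow> rat poly" where
  "binom_poly a n = smult (1 / fact n) (\<Prod>i=0..<n. a - of_nat i)"

text \<open>The binomial series $(1 + x)^a$, i.e. \<^const>\<open>fps_binomial\<close> without its restriction to
  fields as coefficient rings.\<close>

definition fps_binom_series :: "rat poly \<Rightarrow> rat poly fps" where
  "fps_binom_series a = Abs_fps (binom_poly a)"

definition chain_series :: "(nat \<Rightarrow> 'a rgraph) \<Rightarrow> rat poly fps" where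
  "chain_series C = Abs_fps (\<lambda>n. if n = 0 then 1 else psi (C n))"

definition shrub_series :: "(nat \<Rightarrow> 'a rgraph) \<Rightarrow> rat poly fps" where
  "shrub_series S = Abs_fps (\<lambda>n. smult (1 / fact n) (psi (S n)))"

lemma fps_Exp_X_minus_1_nonzero: "fps_Exp fps_X - 1 \<noteq> 0"
proof -
  have "fps_nth (fps_Exp fps_X - 1) 1 \<noteq> 0"
    by (simp add: fps_Exp_def fps_lift_def)
  then show ?thesis by auto
qed

end

theory Submission
  imports Defs
begin

text \<open>
  Write $a_k(T)$ for the sum of $\phi_{T_{\vec e,1}} \cdots \phi_{T_{\vec e,k+1}}$ over the sequences
  $e_1 \succ \cdots \succ e_k$ (\<open>cut_sum T k\<close> below).  Then $\phi_T = a_0(T)$,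
  $\psi_T(t) = \sum_k a_k(T)\, t^{k+1}/(k+1)!$, and the recursion for $\phi$ says that
  $\psi_T(1) = 0$ unless $T$ is a single vertex.  A sequence that starts with \<open>e\<close> continues with
  a sequence of the tree $T_e$, so that
  $a_{k+1}(T) = \sum_{e \in E(T)} \phi_{T'_e}\, a_k(T_e)$ (\<open>cut_sum_Suc\<close>).  For both families the
  trees $T_e$ stay in the family, and the recurrence becomes an identity of power series.

  Cutting the chain with $n$ vertices at an edge gives two chains whose sizes add up to $n$, and each
  split of $n$ into two positive sizes occurs once.  So $a_k(C_n)$ is the coefficient of $x^n$ in
  $\Phi^{k+1}$, where $\Phi = \sum_{n \ge 1} \phi_{C_n} x^n$, and the chain series is $e^{t\Phi}$.
  Its value $1 + x$ at $t = 1$ forces $\Phi = \ln(1 + x)$.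

  Cutting the shrub with $n$ leaves at any of its $n$ edges gives a single vertex and the shrub with
  $n - 1$ leaves.  So $a_k(S_n)/n! = b_{n-k}$, where $b_m = \phi_{S_m}/m!$, and
  $x\,\mathcal{S}(t,x) = (e^{tx} - 1)\,B(x)$ for $B = \sum_m b_m x^m$.  At $t = 1$ the left-hand side
  is $x$, so $B = x/(e^x - 1)$.

  The proofs run this in the opposite order: $\ln(1 + x)$ and $x/(e^x - 1)$ are given, and strong
  induction on the size of the tree (\<open>cut_sum_path_graph\<close>, \<open>cut_sum_star_graph\<close>) shows that their
  coefficients are $\phi_{C_n}$ and $\phi_{S_n}/n!$.
\<close>

section \<open>Cutting a rooted tree\<close>

lemma adj_rtrancl_mono: "F \<subseteq> G \<Longrightarrow> (adj F)\<^sup>* \<subseteq> (adj G)\<^sup>*"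
  by (rule rtrancl_mono) (auto simp: adj_def)

text \<open>Cut a walk from \<open>x\<close> to \<open>y\<close> at its first and its last use of the edge.  The initial and the final
  part stop at different ends of the edge, since otherwise they would form a walk that avoids it.\<close>

lemma rtrancl_split_edge:
  assumes "(x, y) \<in> (adj F)\<^sup>*" and "(x, y) \<notin> (adj (F - {{u, v}}))\<^sup>*"
  shows "((x, u) \<in> (adj (F - {{u, v}}))\<^sup>* \<and> (v, y) \<in> (adj (F - {{u, v}}))\<^sup>*) \<or>
         ((x, v) \<in> (adj (F - {{u, v}}))\<^sup>* \<and> (u, y) \<in> (adj (F - {{u, v}}))\<^sup>*)"
  using assms
proof (induction rule: rtrancl_induct)
  case (step y z)
  let ?R = "adj (F - {{u, v}})"
  show ?case
  proof (cases "{y, z} = {u, v}")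
    case False
    then have yz: "(y, z) \<in> ?R" using step.hyps by (auto simp: adj_def)
    with step.prems have "(x, y) \<notin> ?R\<^sup>*" by (meson rtrancl.rtrancl_into_rtrancl)
    with step.IH yz show ?thesis by (meson rtrancl.rtrancl_into_rtrancl)
  next
    case True
    then have yz: "y = u \<and> z = v \<or> y = v \<and> z = u" by (auto simp: doubleton_eq_iff)
    show ?thesis
    proof (cases "(x, y) \<in> ?R\<^sup>*")
      case True
      with yz show ?thesis by auto
    next
      case False
      with step.IH yz step.prems show ?thesis by auto
    qed
  qed
qed simp

text \<open>In a forest the two walks have to run along the same path, which avoids both edges.  Otherwise \<open>e\<close>
  would separate \<open>x\<close> from \<open>y\<close> once \<open>f\<close> is gone; together with the walk that avoids \<open>e\<close>, this joins
  the ends of \<open>e\<close> without using \<open>e\<close>, although \<open>e\<close> is a bridge.\<close>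

lemma reachable_avoiding_two_edges:
  assumes acyclic: "\<nexists>p. is_cycle F p" and e: "e \<in> F" "card e = 2"
    and "(x, y) \<in> (adj (F - {e}))\<^sup>*" and "(x, y) \<in> (adj (F - {f}))\<^sup>*"
  shows "(x, y) \<in> (adj (F - {e} - {f}))\<^sup>*"
proof (rule ccontr)
  assume not: "(x, y) \<notin> (adj (F - {e} - {f}))\<^sup>*"
  obtain u v where uv: "e = {u, v}" "u \<noteq> v" using e(2) by (auto simp: card_2_iff)
  have swap: "F - {e} - {f} = F - {f} - {{u, v}}" using uv by auto
  have sub: "(adj (F - {f} - {{u, v}}))\<^sup>* \<subseteq> (adj (F - {e}))\<^sup>*"
    by (intro adj_rtrancl_mono) (auto simp: uv)
  have "((x, u) \<in> (adj (F - {e}))\<^sup>* \<and> (v, y) \<in> (adj (F - {e}))\<^sup>*) \<or>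
         ((x, v) \<in> (adj (F - {e}))\<^sup>* \<and> (u, y) \<in> (adj (F - {e}))\<^sup>*)"
    using rtrancl_split_edge[OF assms(5), of u v] not sub swap by auto
  then have "(u, v) \<in> (adj (F - {e}))\<^sup>*"
    using assms(4) by (meson adj_rtrancl_sym rtrancl_trans)
  with bridge[OF acyclic, of u v] e uv show False by simp
qed

lemma root_component [simp]: "root (component T e r) = r"
  by (simp add: component_def Let_def)

lemma verts_component:
  "verts (component T e r) = {v \<in> verts T. (r, v) \<in> (adj (edges T - {e}))\<^sup>*}"
  by (simp add: component_def Let_def)

lemma edges_component:
  "edges (component T e r) = {f \<in> edges T - {e}. f \<subseteq> verts (component T e r)}"
  by (simp add: component_def Let_def)

text \<open>A walk that starts at \<open>r\<close> and avoids \<open>e\<close> never leaves the component of \<open>r\<close>.\<close>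

lemma reachable_component_avoiding:
  assumes T: "rooted_tree T"
  shows "(r, v) \<in> (adj (edges (component T e r) - X))\<^sup>* \<longleftrightarrow> (r, v) \<in> (adj (edges T - {e} - X))\<^sup>*"
proof
  show "(r, v) \<in> (adj (edges T - {e} - X))\<^sup>*"
    if "(r, v) \<in> (adj (edges (component T e r) - X))\<^sup>*"
  proof -
    have "(adj (edges (component T e r) - X))\<^sup>* \<subseteq> (adj (edges T - {e} - X))\<^sup>*"
      by (intro adj_rtrancl_mono) (auto simp: edges_component)
    with that show ?thesis by blast
  qed
next
  assume "(r, v) \<in> (adj (edges T - {e} - X))\<^sup>*"
  then show "(r, v) \<in> (adj (edges (component T e r) - X))\<^sup>*"
  proof (induction rule: rtrancl_induct)
    case (step y z)
    have sub: "(adj (edges T - {e} - X))\<^sup>* \<subseteq> (adj (edges T - {e}))\<^sup>*"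
      by (intro adj_rtrancl_mono) auto
    have "(r, z) \<in> (adj (edges T - {e} - X))\<^sup>*"
      using step.hyps by (rule rtrancl_into_rtrancl)
    moreover have "{y, z} \<in> edges T" "{y, z} \<in> edges T - {e} - X"
      using step.hyps by (auto simp: adj_def)
    moreover have "{y, z} \<subseteq> verts T" using T calculation by (auto simp: rooted_tree_def)
    ultimately have "(y, z) \<in> adj (edges (component T e r) - X)"
      using step.hyps sub by (auto simp: adj_def edges_component verts_component)
    with step.IH show ?case by (rule rtrancl_into_rtrancl)
  qed simp
qed

lemma rooted_tree_component:
  assumes T: "rooted_tree T" and r: "r \<in> verts T"
  shows "rooted_tree (component T e r)"
proof -
  let ?C = "component T e r"
  have reach: "(r, v) \<in> (adj (edges ?C))\<^sup>*" if "v \<in> verts ?C" for v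
    using reachable_component_avoiding[OF T, of r v e "{}"] that by (simp add: verts_component)
  then have "(u, v) \<in> (adj (edges ?C))\<^sup>*" if "u \<in> verts ?C" "v \<in> verts ?C" for u v
    using that by (meson adj_rtrancl_sym rtrancl_trans)
  moreover have "is_cycle (edges T) p" if "is_cycle (edges ?C) p" for p
    using that by (auto simp: is_cycle_def edges_component)
  moreover have "finite (verts ?C)" "r \<in> verts ?C"
    using T r by (auto simp: verts_component rooted_tree_def)
  moreover have "\<forall>f\<in>edges ?C. f \<subseteq> verts ?C \<and> card f = 2"
    using T by (auto simp: rooted_tree_def edges_component)
  ultimately show ?thesis
    using T unfolding rooted_tree_def root_component by blast
qed

text \<open>An edge of a tree separates its far end from the root, so the end that stays connected with the
  root is the near one; this avoids computing depths.\<close>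

lemma far_end_eqI:
  assumes "rooted_tree T" and "{u, v} \<in> edges T"
    and "(root T, u) \<in> (adj (edges T - {{u, v}}))\<^sup>*"
  shows "far_end T {u, v} = v"
proof -
  from edge_ends[OF assms(1,2)] obtain a b where ab: "{u, v} = {a, b}" "far_end T {u, v} = b"
    "(root T, b) \<notin> (adj (edges T - {{u, v}}))\<^sup>*" by metis
  with assms(3) have "u \<noteq> b" by metis
  with ab(1) have "b = v" by (auto simp: doubleton_eq_iff)
  with ab(2) show ?thesis by simp
qed

lemma rooted_tree_cut:
  assumes T: "rooted_tree T" and e: "e \<in> edges T"
  shows "rooted_tree (cut_root T e)" "rooted_tree (cut_off T e)"
proof -
  have "root T \<in> verts T" using T by (simp add: rooted_tree_def)
  moreover have "far_end T e \<in> verts T"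
  proof -
    from edge_ends[OF T e] obtain u v where "e = {u, v}" "far_end T e = v" by metis
    with T e show ?thesis by (auto simp: rooted_tree_def)
  qed
  ultimately show "rooted_tree (cut_root T e)" "rooted_tree (cut_off T e)"
    using rooted_tree_component[OF T] by (simp_all add: cut_root_def cut_off_def)
qed

text \<open>Both sides ask whether \<open>g\<close> remains attached to the root when \<open>f\<close> is removed, and by
  \<open>reachable_avoiding_two_edges\<close> the additional removal of \<open>e\<close> does not change the answer.  This is
  what makes the admissible sequences recursive.\<close>

lemma edge_succ_cut_root:
  assumes T: "rooted_tree T" and e: "e \<in> edges T" and g: "g \<in> edges (cut_root T e)"
  shows "edge_succ (cut_root T e) f g \<longleftrightarrow> edge_succ T f g"
proof -
  let ?F = "edges T" and ?r = "root T"
  have two: "(?r, v) \<in> (adj (?F - {e} - {f}))\<^sup>* \<longleftrightarrow>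
      (?r, v) \<in> (adj (?F - {e}))\<^sup>* \<and> (?r, v) \<in> (adj (?F - {f}))\<^sup>*" for v
  proof
    have "(adj (?F - {e} - {f}))\<^sup>* \<subseteq> (adj (?F - {e}))\<^sup>*" "(adj (?F - {e} - {f}))\<^sup>* \<subseteq> (adj (?F - {f}))\<^sup>*"
      by (auto intro!: adj_rtrancl_mono)
    then show "(?r, v) \<in> (adj (?F - {e} - {f}))\<^sup>* \<Longrightarrow>
      (?r, v) \<in> (adj (?F - {e}))\<^sup>* \<and> (?r, v) \<in> (adj (?F - {f}))\<^sup>*" by blast
  next
    show "(?r, v) \<in> (adj (?F - {e}))\<^sup>* \<and> (?r, v) \<in> (adj (?F - {f}))\<^sup>* \<Longrightarrow>
      (?r, v) \<in> (adj (?F - {e} - {f}))\<^sup>*"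
      using reachable_avoiding_two_edges[of ?F e] T e by (auto simp: rooted_tree_def)
  qed
  have "verts (cut_root (cut_root T e) f) = verts (cut_root T e) \<inter> verts (cut_root T f)"
    by (auto simp: cut_root_def verts_component reachable_component_avoiding[OF T] two)
  with g show ?thesis
    by (auto simp: edge_succ_def cut_root_def edges_component)
qed

lemma edge_seqs_Suc:
  assumes T: "rooted_tree T"
  shows "edge_seqs T (Suc r) = (\<Union>e\<in>edges T. (#) e ` edge_seqs (cut_root T e) r)"
proof -
  have sub: "edges (cut_root T e) \<subseteq> edges T" for e
    by (auto simp: cut_root_def edges_component)
  have "e # es \<in> edge_seqs T (Suc r) \<longleftrightarrow> es \<in> edge_seqs (cut_root T e) r"
    if e: "e \<in> edges T" for e es
  proof -
    have "sorted_wrt (edge_succ T) es \<longleftrightarrow> sorted_wrt (edge_succ (cut_root T e)) es"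
      if "set es \<subseteq> edges (cut_root T e)"
      using that edge_succ_cut_root[OF T e]
      by (auto simp: sorted_wrt_iff_nth_less subset_iff)
    then show ?thesis
      using e sub[of e] unfolding edge_seqs_def
      by (simp add: edge_succ_def subset_iff) blast
  qed
  note step = this
  show ?thesis
  proof (rule set_eqI)
    fix l
    show "l \<in> edge_seqs T (Suc r) \<longleftrightarrow> l \<in> (\<Union>e\<in>edges T. (#) e ` edge_seqs (cut_root T e) r)"
    proof (cases l)
      case (Cons e es)
      have "e \<in> edges T" if "l \<in> edge_seqs T (Suc r)" using that Cons by (simp add: edge_seqs_def)
      with step[of e es] Cons show ?thesis by auto
    qed (auto simp: edge_seqs_def)
  qed
qed

text \<open>The inner sums of $\phi_T$ and $\psi_T$, indexed by the number \<open>k\<close> of cut edges, which is one less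
  than the number of factors.\<close>

definition cut_sum :: "'a rgraph \<Rightarrow> nat \<Rightarrow> rat" where
  "cut_sum T k = (\<Sum>es\<in>edge_seqs T k. prod_list (map phi (pieces T es)))"

lemma cut_sum_0 [simp]: "cut_sum T 0 = phi T"
proof -
  have "edge_seqs T 0 = {[]}" by (auto simp: edge_seqs_def)
  then show ?thesis by (simp add: cut_sum_def)
qed

lemma finite_edges: "rooted_tree T \<Longrightarrow> finite (edges T)"
  by (rule finite_subset[of _ "Pow (verts T)"]) (auto simp: rooted_tree_def)

lemma cut_sum_Suc:
  assumes T: "rooted_tree T"
  shows "cut_sum T (Suc k) = (\<Sum>e\<in>edges T. phi (cut_off T e) * cut_sum (cut_root T e) k)"
proof -
  have "finite (edge_seqs (cut_root T e) k)" if "e \<in> edges T" for e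
    using finite_edges[OF rooted_tree_cut(1)[OF T that]]
    by (intro finite_subset[OF _ finite_lists_length_eq[of _ k]]) (auto simp: edge_seqs_def)
  then have "cut_sum T (Suc k) = (\<Sum>e\<in>edges T. \<Sum>es\<in>(#) e ` edge_seqs (cut_root T e) k.
      prod_list (map phi (pieces T es)))"
    unfolding cut_sum_def edge_seqs_Suc[OF T]
    using finite_edges[OF T] by (intro sum.UNION_disjoint) auto
  also have "\<dots> = (\<Sum>e\<in>edges T. phi (cut_off T e) * cut_sum (cut_root T e) k)"
    by (simp add: sum.reindex cut_sum_def sum_distrib_left)
  finally show ?thesis .
qed

lemma phi_single:
  assumes "rooted_tree T" "card (verts T) = 1"
  shows "phi T = 1"
  using assms by (subst phi.simps) simp

lemma phi_recursion:
  assumes "rooted_tree T" "card (verts T) = Suc n" "1 \<le> n"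
  shows "phi T = - (\<Sum>k=1..n. cut_sum T k / fact (Suc k))"
proof -
  have "phi T = - (\<Sum>k=Suc 1..Suc n. 1 / fact k * cut_sum T (k - 1))"
    using assms by (subst phi.simps) (simp add: cut_sum_def numeral_2_eq_2)
  also have "\<dots> = - (\<Sum>k=1..n. cut_sum T k / fact (Suc k))"
    by (subst sum.shift_bounds_cl_Suc_ivl) (simp del: fact_Suc)
  finally show ?thesis .
qed

lemma psi_cut_sum:
  "psi T = (\<Sum>k<card (verts T). monom (cut_sum T k / fact (Suc k)) (Suc k))"
proof -
  have "psi T = (\<Sum>k=1..card (verts T). monom (1 / fact k * cut_sum T (k - 1)) k)"
    by (simp add: psi_def cut_sum_def)
  also have "\<dots> = (\<Sum>k<card (verts T). monom (1 / fact (Suc k) * cut_sum T (Suc k - 1)) (Suc k))"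
    by (intro sum.reindex_bij_witness[of _ Suc "\<lambda>k. k - 1"]) auto
  finally show ?thesis by simp
qed

section \<open>Chains and shrubs as explicit graphs\<close>

text \<open>Used to compute the trees that arise from explicit graphs: connectedness places \<open>V\<close> inside the
  component, and the absence of an edge leaving \<open>V\<close> gives the other inclusion.\<close>

lemma component_eqI:
  assumes r: "r \<in> V" and V: "V \<subseteq> verts T"
    and reach: "\<And>v. v \<in> V \<Longrightarrow> (r, v) \<in> (adj (edges T - {e}))\<^sup>*"
    and closed: "\<And>u v. {u, v} \<in> edges T - {e} \<Longrightarrow> u \<in> V \<Longrightarrow> v \<in> V"
  shows "component T e r = RGraph V {f \<in> edges T - {e}. f \<subseteq> V} r"
proof -
  have "v \<in> V" if "(r, v) \<in> (adj (edges T - {e}))\<^sup>*" for v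
    using that
  proof (induction rule: rtrancl_induct)
    case (step y z)
    then show ?case using closed by (auto simp: adj_def)
  qed (rule r)
  with reach V have "{v \<in> verts T. (r, v) \<in> (adj (edges T - {e}))\<^sup>*} = V" by blast
  then show ?thesis by (simp add: component_def Let_def)
qed

definition path_graph :: "(nat \<Rightarrow> 'a) \<Rightarrow> nat \<Rightarrow> 'a rgraph" where
  "path_graph f n = RGraph (f ` {..<n}) {{f i, f (Suc i)} |i. Suc i < n} (f 0)"

text \<open>A shortest path from the root to a vertex at depth $n - 1$ already visits $n$ distinct vertices, hence
  all of them.  An edge between vertices of the path that are not consecutive would be a shortcut.\<close>

lemma is_chain_imp_path_graph:
  assumes "is_chain n T"
  obtains f where "T = path_graph f n" "inj_on f {..<n}"
proof -
  have T: "rooted_tree T" and card: "card (verts T) = n" and h: "height T = n - 1"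
    using assms by (auto simp: is_chain_def)
  have fin: "finite (verts T)" and rt: "root T \<in> verts T"
    and edge: "\<And>e. e \<in> edges T \<Longrightarrow> e \<subseteq> verts T \<and> card e = 2"
    using T by (auto simp: rooted_tree_def)
  have "n \<noteq> 0" using card fin rt by (metis card_eq_0_iff empty_iff)
  have "Max (depth T ` verts T) \<in> depth T ` verts T"
    using fin rt by (intro Max_in) auto
  then obtain v where v: "v \<in> verts T" "n - 1 = depth T v"
    using h by (auto simp: height_def)
  have "(root T, v) \<in> (adj (edges T))\<^sup>*" using T v rt by (auto simp: rooted_tree_def)
  from shortest_path[OF this v(2)[unfolded depth_def]] obtain f
    where f: "f 0 = root T" "f (n - 1) = v" "\<And>i. i < n - 1 \<Longrightarrow> (f i, f (Suc i)) \<in> adj (edges T)"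
      and inj: "inj_on f {..n - 1}" by metis
  have lessThan: "{..n - 1} = {..<n}" using \<open>n \<noteq> 0\<close> by auto
  have walk: "{f i, f (Suc i)} \<in> edges T" if "Suc i < n" for i
    using f(3)[of i] that by (auto simp: adj_def)
  have "f i \<in> verts T" if "i < n" for i
    using that
  proof (cases i)
    case (Suc j)
    then show ?thesis using edge[OF walk[of j]] that by auto
  qed (use f rt in auto)
  then have "f ` {..<n} \<subseteq> verts T" by auto
  moreover have "card (f ` {..<n}) = card (verts T)"
    using card_image[OF inj] lessThan card \<open>n \<noteq> 0\<close> by simp
  ultimately have verts: "f ` {..<n} = verts T" using fin by (intro card_subset_eq)
  have no_chord: "j = Suc i" if "{f i, f j} \<in> edges T" "i < j" "j < n" for i j
  proof (rule ccontr)
    assume "j \<noteq> Suc i"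
    have "(root T, f i) \<in> adj (edges T) ^^ i"
      unfolding relpow_fun_conv using f that by (intro exI[of _ f]) auto
    then have "(root T, f j) \<in> adj (edges T) ^^ Suc i"
      using that by (auto simp: adj_def)
    moreover have "(f j, v) \<in> adj (edges T) ^^ (n - 1 - j)"
      unfolding relpow_fun_conv using f that by (intro exI[of _ "\<lambda>k. f (j + k)"]) auto
    ultimately have "(root T, v) \<in> adj (edges T) ^^ (Suc i + (n - 1 - j))"
      unfolding relpow_add by blast
    then have "n - 1 \<le> Suc i + (n - 1 - j)"
      unfolding v(2) depth_def by (rule Least_le)
    with that \<open>j \<noteq> Suc i\<close> show False by linarith
  qed
  have "\<exists>i. e = {f i, f (Suc i)} \<and> Suc i < n" if "e \<in> edges T" for e
  proof -
    obtain a b where ab: "e = {a, b}" "a \<noteq> b" using edge[OF \<open>e \<in> edges T\<close>] unfolding card_2_iff by blast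
    have "a \<in> f ` {..<n}" "b \<in> f ` {..<n}" using edge[OF that] ab(1) verts by auto
    then obtain i j where ij: "a = f i" "b = f j" "i < n" "j < n" by auto
    consider "i < j" | "j < i" using ab ij by force
    then show ?thesis
    proof cases
      case 1
      then have "j = Suc i" using no_chord[of i j] ij ab that by simp
      with ij ab show ?thesis by blast
    next
      case 2
      then have "i = Suc j" using no_chord[of j i] ij ab that by (simp add: insert_commute)
      with ij ab show ?thesis by (auto simp: insert_commute)
    qed
  qed
  with walk have "edges T = {{f i, f (Suc i)} |i. Suc i < n}" by blast
  with verts f(1) have "T = path_graph f n" by (cases T) (simp add: path_graph_def)
  with inj lessThan that show thesis by simp
qed

lemma cut_path_graph:
  assumes T: "rooted_tree (path_graph f n)" and inj: "inj_on f {..<n}" and i: "Suc i < n"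
  shows "cut_root (path_graph f n) {f i, f (Suc i)} = path_graph f (Suc i)"
    and "cut_off (path_graph f n) {f i, f (Suc i)} = path_graph (\<lambda>j. f (Suc i + j)) (n - Suc i)"
proof -
  let ?T = "path_graph f n" and ?e = "{f i, f (Suc i)}"
  have eq: "f a = f b \<longleftrightarrow> a = b" if "a < n" "b < n" for a b
    using inj that by (auto simp: inj_on_def)
  have edges: "edges ?T - {?e} = {{f j, f (Suc j)} |j. Suc j < n \<and> j \<noteq> i}"
    using i eq by (auto simp: path_graph_def doubleton_eq_iff)
  have walk: "(f a, f (a + d)) \<in> (adj (edges ?T - {?e}))\<^sup>*"
    if "a + d < n" "i < a \<or> a + d \<le> i" for a d
    using that
  proof (induction d)
    case (Suc d)
    then have "(f (a + d), f (a + Suc d)) \<in> adj (edges ?T - {?e})"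
      by (auto simp: adj_def edges)
    with Suc show ?case by (auto intro: rtrancl_into_rtrancl)
  qed simp
  have below: "component ?T ?e (f 0) = RGraph (f ` {..<Suc i}) {g \<in> edges ?T - {?e}. g \<subseteq> f ` {..<Suc i}} (f 0)"
  proof (rule component_eqI)
    show "(f 0, v) \<in> (adj (edges ?T - {?e}))\<^sup>*" if "v \<in> f ` {..<Suc i}" for v
      using that i walk[of 0] by auto
    show "v \<in> f ` {..<Suc i}" if "{u, v} \<in> edges ?T - {?e}" "u \<in> f ` {..<Suc i}" for u v
      using that i eq unfolding edges by (auto simp: doubleton_eq_iff less_Suc_eq_le)
  qed (use i in \<open>auto simp: path_graph_def\<close>)
  also have "{g \<in> edges ?T - {?e}. g \<subseteq> f ` {..<Suc i}} = {{f j, f (Suc j)} |j. Suc j < Suc i}"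
  proof (intro equalityI subsetI)
    fix g assume "g \<in> {g \<in> edges ?T - {?e}. g \<subseteq> f ` {..<Suc i}}"
    then obtain j where j: "g = {f j, f (Suc j)}" "Suc j < n" "f (Suc j) \<in> f ` {..<Suc i}"
      unfolding edges by auto
    then have "Suc j < Suc i" using i eq by auto
    with j show "g \<in> {{f j, f (Suc j)} |j. Suc j < Suc i}" by blast
  next
    fix g assume "g \<in> {{f j, f (Suc j)} |j. Suc j < Suc i}"
    then obtain j where "g = {f j, f (Suc j)}" "j < i" by auto
    with i show "g \<in> {g \<in> edges ?T - {?e}. g \<subseteq> f ` {..<Suc i}}"
      unfolding edges by (auto intro!: exI[of _ j])
  qed
  finally show "cut_root ?T ?e = path_graph f (Suc i)"
    by (simp add: cut_root_def path_graph_def)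
  have root: "root ?T = f 0" by (simp add: path_graph_def)
  have far: "far_end ?T ?e = f (Suc i)"
    using i walk[of 0 i] by (intro far_end_eqI[OF T]) (auto simp: path_graph_def root)
  have img: "(\<lambda>j. f (Suc i + j)) ` {..<n - Suc i} = f ` {Suc i..<n}"
  proof (intro equalityI subsetI)
    fix x assume "x \<in> f ` {Suc i..<n}"
    then obtain j where "x = f j" "Suc i \<le> j" "j < n" by auto
    then show "x \<in> (\<lambda>j. f (Suc i + j)) ` {..<n - Suc i}"
      by (intro image_eqI[of _ _ "j - Suc i"]) auto
  qed auto
  have "component ?T ?e (f (Suc i)) = RGraph (f ` {Suc i..<n}) {g \<in> edges ?T - {?e}. g \<subseteq> f ` {Suc i..<n}} (f (Suc i))"
  proof (rule component_eqI)
    show "(f (Suc i), v) \<in> (adj (edges ?T - {?e}))\<^sup>*" if "v \<in> f ` {Suc i..<n}" for v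
    proof -
      from that obtain j where "v = f j" "Suc i \<le> j" "j < n" by auto
      with walk[of "Suc i" "j - Suc i"] show ?thesis by simp
    qed
    show "v \<in> f ` {Suc i..<n}" if "{u, v} \<in> edges ?T - {?e}" "u \<in> f ` {Suc i..<n}" for u v
      using that i eq unfolding edges by (auto simp: doubleton_eq_iff)
  qed (use i in \<open>auto simp: path_graph_def\<close>)
  also have "{g \<in> edges ?T - {?e}. g \<subseteq> f ` {Suc i..<n}} =
      {{f (Suc i + j), f (Suc i + Suc j)} |j. Suc j < n - Suc i}"
  proof (intro equalityI subsetI)
    fix g assume "g \<in> {g \<in> edges ?T - {?e}. g \<subseteq> f ` {Suc i..<n}}"
    then obtain j where j: "g = {f j, f (Suc j)}" "Suc j < n" "f j \<in> f ` {Suc i..<n}"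
      unfolding edges by auto
    then have "Suc i \<le> j" using eq by auto
    with j show "g \<in> {{f (Suc i + j), f (Suc i + Suc j)} |j. Suc j < n - Suc i}"
      by (auto intro!: exI[of _ "j - Suc i"])
  next
    fix g assume "g \<in> {{f (Suc i + j), f (Suc i + Suc j)} |j. Suc j < n - Suc i}"
    then obtain j where "g = {f (Suc i + j), f (Suc (Suc i + j))}" "Suc (Suc i + j) < n" by auto
    then show "g \<in> {g \<in> edges ?T - {?e}. g \<subseteq> f ` {Suc i..<n}}"
      unfolding edges by (auto intro!: exI[of _ "Suc (i + j)"])
  qed
  finally show "cut_off ?T ?e = path_graph (\<lambda>j. f (Suc i + j)) (n - Suc i)"
    unfolding cut_off_def far unfolding path_graph_def img by simp
qed

lemma cut_sum_path_graph_Suc: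
  assumes T: "rooted_tree (path_graph f n)" and inj: "inj_on f {..<n}"
  shows "cut_sum (path_graph f n) (Suc k) =
    (\<Sum>i<n - 1. phi (path_graph (\<lambda>j. f (Suc i + j)) (n - Suc i)) * cut_sum (path_graph f (Suc i)) k)"
proof -
  let ?e = "\<lambda>i. {f i, f (Suc i)}"
  have "edges (path_graph f n) = ?e ` {..<n - 1}"
    by (auto simp: path_graph_def)
  moreover have "inj_on ?e {..<n - 1}"
  proof (rule inj_onI)
    fix i j assume "i \<in> {..<n - 1}" "j \<in> {..<n - 1}" "?e i = ?e j"
    then show "i = j"
      using inj by (auto simp: doubleton_eq_iff inj_on_eq_iff)
  qed
  ultimately show ?thesis
    by (simp add: cut_sum_Suc[OF T] sum.reindex cut_path_graph[OF T inj])
qed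

definition star_graph :: "'a \<Rightarrow> 'a set \<Rightarrow> 'a rgraph" where
  "star_graph r L = RGraph (insert r L) ((\<lambda>v. {r, v}) ` L) r"

text \<open>An edge that misses the root would close a triangle with the edges from the root to its ends.\<close>

lemma is_shrub_imp_star_graph:
  assumes "is_shrub n T"
  obtains r L where "T = star_graph r L" "finite L" "card L = n" "r \<notin> L"
proof -
  define r where "r = root T"
  define L where "L = verts T - {r}"
  have T: "rooted_tree T" and card: "card (verts T) = n + 1"
    and star: "\<And>v. v \<in> L \<Longrightarrow> {r, v} \<in> edges T"
    using assms by (auto simp: is_shrub_def r_def L_def)
  have fin: "finite (verts T)" and rt: "r \<in> verts T"
    and edge: "\<And>e. e \<in> edges T \<Longrightarrow> e \<subseteq> verts T \<and> card e = 2"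
    and acyclic: "\<nexists>p. is_cycle (edges T) p"
    using T by (auto simp: rooted_tree_def r_def)
  have "e \<in> (\<lambda>v. {r, v}) ` L" if "e \<in> edges T" for e
  proof -
    obtain a b where ab: "e = {a, b}" "a \<noteq> b" using edge[OF \<open>e \<in> edges T\<close>] unfolding card_2_iff by blast
    have "a = r \<or> b = r"
    proof (rule ccontr)
      assume "\<not> (a = r \<or> b = r)"
      with ab edge[OF that] have *: "a \<in> L" "b \<in> L" "a \<noteq> r" "b \<noteq> r" by (auto simp: L_def)
      have "is_cycle (edges T) [r, a, b]"
        unfolding is_cycle_def using * ab that star[of a] star[of b]
        by (auto simp: less_Suc_eq insert_commute)
      with acyclic show False by blast
    qed
    with ab edge[OF that] show ?thesis by (auto simp: L_def insert_commute)
  qed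
  with star have "edges T = (\<lambda>v. {r, v}) ` L" by blast
  moreover have "verts T = insert r L" using rt by (auto simp: L_def)
  ultimately have "T = star_graph r L" by (cases T) (simp add: star_graph_def r_def)
  moreover have "finite L" "card L = n" "r \<notin> L" using fin rt card by (auto simp: L_def)
  ultimately show thesis using that by blast
qed

lemma cut_star_graph:
  assumes T: "rooted_tree (star_graph r L)" and r: "r \<notin> L" and v: "v \<in> L"
  shows "cut_root (star_graph r L) {r, v} = star_graph r (L - {v})"
    and "cut_off (star_graph r L) {r, v} = RGraph {v} {} v"
proof -
  let ?T = "star_graph r L" and ?e = "{r, v}"
  have edges: "edges ?T - {?e} = (\<lambda>u. {r, u}) ` (L - {v})"
    using r v by (auto simp: star_graph_def doubleton_eq_iff)
  have root: "root ?T = r" by (simp add: star_graph_def)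
  have "component ?T ?e r = RGraph (insert r (L - {v})) {g \<in> edges ?T - {?e}. g \<subseteq> insert r (L - {v})} r"
  proof (rule component_eqI)
    show "(r, u) \<in> (adj (edges ?T - {?e}))\<^sup>*" if "u \<in> insert r (L - {v})" for u
    proof (cases "u = r")
      case False
      with that have "(r, u) \<in> adj (edges ?T - {?e})" unfolding edges adj_def by auto
      then show ?thesis ..
    qed simp
    show "b \<in> insert r (L - {v})" if "{a, b} \<in> edges ?T - {?e}" for a b
      using that unfolding edges by (auto simp: doubleton_eq_iff)
  qed (auto simp: star_graph_def)
  also have "{g \<in> edges ?T - {?e}. g \<subseteq> insert r (L - {v})} = (\<lambda>u. {r, u}) ` (L - {v})"
    unfolding edges by auto
  finally show "cut_root ?T ?e = star_graph r (L - {v})"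
    unfolding cut_root_def root by (simp add: star_graph_def)
  have far: "far_end ?T ?e = v"
    using v by (intro far_end_eqI[OF T]) (auto simp: star_graph_def)
  have "component ?T ?e v = RGraph {v} {g \<in> edges ?T - {?e}. g \<subseteq> {v}} v"
  proof (rule component_eqI)
    show "b \<in> {v}" if "{a, b} \<in> edges ?T - {?e}" "a \<in> {v}" for a b
      using that r v unfolding edges by (auto simp: doubleton_eq_iff)
  qed (use v in \<open>auto simp: star_graph_def\<close>)
  also have "{g \<in> edges ?T - {?e}. g \<subseteq> {v}} = {}"
    using r v unfolding edges by auto
  finally show "cut_off ?T ?e = RGraph {v} {} v"
    unfolding cut_off_def far .
qed

lemma cut_sum_star_graph_Suc:
  assumes T: "rooted_tree (star_graph r L)" and r: "r \<notin> L"
  shows "cut_sum (star_graph r L) (Suc k) = (\<Sum>v\<in>L. cut_sum (star_graph r (L - {v})) k)"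
proof -
  have "edges (star_graph r L) = (\<lambda>v. {r, v}) ` L"
    by (simp add: star_graph_def)
  moreover have "inj_on (\<lambda>v. {r, v}) L"
    by (auto simp: inj_on_def doubleton_eq_iff)
  moreover have "phi (RGraph {v} {} v) = 1" if "v \<in> L" for v
  proof (rule phi_single)
    have "{r, v} \<in> edges (star_graph r L)" using that by (simp add: star_graph_def)
    from rooted_tree_cut(2)[OF T this] show "rooted_tree (RGraph {v} {} v)"
      by (simp add: cut_star_graph[OF T r that])
  qed simp
  ultimately show ?thesis
    by (simp add: cut_sum_Suc[OF T] sum.reindex cut_star_graph[OF T r])
qed

section \<open>Cut sums of chains and shrubs\<close>

lemma fps_exp_compose_fps_ln: "fps_exp 1 oo fps_ln 1 = (1 + fps_X :: rat fps)"
proof -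
  have "(fps_exp 1 - 1) oo fps_ln 1 = (fps_X :: rat fps)"
    using fps_inv_right[of "fps_exp 1 - 1 :: rat fps"] by (simp add: fps_ln_fps_exp_inv)
  then show ?thesis by (simp add: fps_compose_sub_distrib algebra_simps)
qed

lemma fps_ln_power_nth_0: "(fps_ln (1::rat) ^ Suc k) $ 0 = 0"
  by (simp add: fps_power_zeroth)

text \<open>The recursion of $\phi$ for chains, satisfied by $\ln(1 + x)$: it is the coefficient of $x^{m+1}$ in
  $\exp(\ln(1 + x)) = 1 + x$, solved for its linear term.\<close>

lemma fps_ln_eq_neg_sum:
  assumes "1 \<le> m"
  shows "fps_ln (1::rat) $ Suc m = - (\<Sum>k=1..m. (fps_ln 1 ^ Suc k) $ Suc m / fact (Suc k))"
proof -
  let ?a = "\<lambda>i. fps_exp (1::rat) $ i * (fps_ln 1 ^ i) $ Suc m"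
  have "(fps_exp 1 oo fps_ln (1::rat)) $ Suc m = 0"
    using assms by (simp add: fps_exp_compose_fps_ln fps_X_nth del: fps_ln_nth)
  then have "0 = (\<Sum>i=0..Suc m. ?a i)" by (simp only: fps_compose_nth)
  also have "\<dots> = (\<Sum>i=0..m. ?a (Suc i))"
    by (simp only: sum.atLeast0_atMost_Suc_shift) (simp del: fact_Suc)
  also have "\<dots> = ?a 1 + (\<Sum>i=1..m. ?a (Suc i))"
    using assms by (subst sum.atLeast_Suc_atMost) auto
  finally show ?thesis
    by (simp add: divide_inverse mult.commute eq_neg_iff_add_eq_0 del: fact_Suc)
qed

text \<open>The cut sums for at least one cut involve only shorter chains, so the induction hypothesis applies to
  both factors of each summand of \<open>cut_sum_path_graph_Suc\<close>, and the sum is a Cauchy product.  The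
  value of $\phi$ on the chain itself follows from these cut sums.\<close>

lemma cut_sum_path_graph:
  assumes "rooted_tree (path_graph f n)" "inj_on f {..<n}"
  shows "cut_sum (path_graph f n) k = (fps_ln 1 ^ Suc k) $ n"
  using assms
proof (induction n arbitrary: f k rule: less_induct)
  case (less n)
  let ?T = "path_graph f n" and ?L = "fps_ln (1::rat)"
  have "f 0 \<in> verts ?T" using less.prems by (simp add: rooted_tree_def path_graph_def)
  then obtain m where n: "n = Suc m" by (cases n) (auto simp: path_graph_def)
  have card: "card (verts ?T) = n" using less.prems by (simp add: path_graph_def card_image)
  have cuts: "cut_sum ?T (Suc k) = (?L ^ Suc (Suc k)) $ n" for k
  proof -
    have "phi (path_graph (\<lambda>j. f (Suc i + j)) (n - Suc i)) = ?L $ (n - Suc i) \<and>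
        cut_sum (path_graph f (Suc i)) k = (?L ^ Suc k) $ Suc i" if "i < m" for i
    proof -
      have i: "Suc i < n" using that n by simp
      then have "{f i, f (Suc i)} \<in> edges ?T" by (auto simp: path_graph_def)
      note trees = rooted_tree_cut[OF less.prems(1) this, unfolded cut_path_graph[OF less.prems i]]
      have "inj_on (\<lambda>j. f (Suc i + j)) {..<n - Suc i}"
        by (rule inj_onI) (auto dest: inj_onD[OF less.prems(2)])
      moreover have "inj_on f {..<Suc i}"
        using less.prems(2) i by (auto intro: inj_on_subset)
      ultimately show ?thesis
        using trees i less.IH[of "n - Suc i" "\<lambda>j. f (Suc i + j)" 0] less.IH[of "Suc i" f k] by simp
    qed
    then have "cut_sum ?T (Suc k) = (\<Sum>i<m. ?L $ (m - i) * (?L ^ Suc k) $ Suc i)"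
      using cut_sum_path_graph_Suc[OF less.prems, of k] n by simp
    \<comment> \<open>Both end terms of the Cauchy product vanish because \<open>ln(1 + x)\<close> has constant term 0.\<close>
    also have "\<dots> = (\<Sum>i\<le>m. ?L $ (m - i) * (?L ^ Suc k) $ Suc i)"
      by (simp add: lessThan_Suc_atMost[symmetric])
    also have "\<dots> = (\<Sum>i=0..n. (?L ^ Suc k) $ i * ?L $ (n - i))"
      unfolding n sum.atLeast0_atMost_Suc_shift fps_ln_power_nth_0
      by (simp add: atLeast0AtMost mult.commute)
    also have "\<dots> = (?L ^ Suc (Suc k)) $ n"
      by (simp add: fps_mult_nth mult.commute[of ?L "?L * _"])
    finally show ?thesis .
  qed
  have "phi ?T = ?L $ n"
  proof (cases "m = 0")
    case True
    then show ?thesis using phi_single[OF less.prems(1)] card n by (simp add: fps_ln_nth)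
  next
    case False
    then have "phi ?T = - (\<Sum>k=1..m. cut_sum ?T k / fact (Suc k))"
      using card n by (intro phi_recursion[OF less.prems(1)]) auto
    also have "\<dots> = - (\<Sum>k=1..m. (?L ^ Suc k) $ n / fact (Suc k))"
    proof -
      have "cut_sum ?T k = (?L ^ Suc k) $ n" if "k \<in> {1..m}" for k
        using that cuts[of "k - 1"] by simp
      then show ?thesis by simp
    qed
    also have "\<dots> = ?L $ n"
      using fps_ln_eq_neg_sum[of m] False n by simp
    finally show ?thesis .
  qed
  with cuts show ?case by (cases k) auto
qed

text \<open>The series $x/(e^x - 1)$, the exponential generating function of the Bernoulli numbers, as the inverse
  of the unit $(e^x - 1)/x$.\<close>

definition x_over_expm1 :: "rat fps" where
  "x_over_expm1 = inverse (fps_shift 1 (fps_exp 1))"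

lemma x_over_expm1_mult: "x_over_expm1 * fps_shift 1 (fps_exp 1) = 1"
  by (simp add: x_over_expm1_def inverse_mult_eq_1)

lemma x_over_expm1_nth_0 [simp]: "x_over_expm1 $ 0 = 1"
  by (simp add: x_over_expm1_def)

text \<open>The recursion of $\phi/n!$ for shrubs, satisfied by $x/(e^x - 1)$.\<close>

lemma x_over_expm1_eq_neg_sum:
  assumes "1 \<le> n"
  shows "x_over_expm1 $ n = - (\<Sum>k=1..n. x_over_expm1 $ (n - k) / fact (Suc k))"
proof -
  have "0 = (fps_shift 1 (fps_exp 1) * x_over_expm1) $ n"
    using x_over_expm1_mult assms by (simp add: mult.commute)
  also have "\<dots> = (\<Sum>k=0..n. x_over_expm1 $ (n - k) / fact (Suc k))"
    by (simp add: fps_mult_nth del: fact_Suc)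
  also have "\<dots> = x_over_expm1 $ n + (\<Sum>k=1..n. x_over_expm1 $ (n - k) / fact (Suc k))"
    by (subst sum.atLeast_Suc_atMost) auto
  finally show ?thesis by simp
qed

text \<open>Each of the $n$ leaves contributes the same summand, so each cut multiplies by the current number of
  leaves: $k$ cuts yield $n(n-1)\cdots(n-k+1)$ times the value of $\phi$ on the shrub with $n - k$
  leaves.\<close>

lemma cut_sum_star_graph:
  assumes "rooted_tree (star_graph r L)" "finite L" "r \<notin> L"
  shows "cut_sum (star_graph r L) k =
    (if k \<le> card L then fact (card L) * x_over_expm1 $ (card L - k) else 0)"
  using assms
proof (induction "card L" arbitrary: L k rule: less_induct)
  case less
  let ?T = "star_graph r L"
  let ?n = "card L"
  have card: "card (verts ?T) = Suc ?n" using less.prems by (simp add: star_graph_def)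
  have cuts: "cut_sum ?T (Suc k) =
    (if Suc k \<le> ?n then fact ?n * x_over_expm1 $ (?n - Suc k) else 0)" for k
  proof (cases "?n")
    case 0
    then have "L = {}" using less.prems by simp
    then show ?thesis unfolding cut_sum_star_graph_Suc[OF less.prems(1,3)] by simp
  next
    case (Suc m)
    have "cut_sum (star_graph r (L - {v})) k =
        (if k \<le> m then fact m * x_over_expm1 $ (m - k) else 0)" if "v \<in> L" for v
    proof -
      have "{r, v} \<in> edges ?T" using that by (simp add: star_graph_def)
      from rooted_tree_cut(1)[OF less.prems(1) this]
      have "rooted_tree (star_graph r (L - {v}))"
        by (simp add: cut_star_graph[OF less.prems(1,3) that])
      moreover have "card (L - {v}) = m" using that Suc less.prems by simp
      ultimately show ?thesis using less.hyps[of "L - {v}" k] less.prems Suc by simp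
    qed
    then show ?thesis
      by (simp add: cut_sum_star_graph_Suc[OF less.prems(1,3)] Suc)
  qed
  have "phi ?T = fact ?n * x_over_expm1 $ ?n"
  proof (cases "?n = 0")
    case True
    then show ?thesis using phi_single[OF less.prems(1)] card by simp
  next
    case False
    then have "phi ?T = - (\<Sum>k=1..?n. cut_sum ?T k / fact (Suc k))"
      using card by (intro phi_recursion[OF less.prems(1)]) auto
    also have "\<dots> = - (\<Sum>k=1..?n. fact ?n * (x_over_expm1 $ (?n - k) / fact (Suc k)))"
    proof -
      have "cut_sum ?T k = fact ?n * x_over_expm1 $ (?n - k)" if "k \<in> {1..?n}" for k
        using that cuts[of "k - 1"] by simp
      then show ?thesis by simp
    qed
    also have "\<dots> = fact ?n * x_over_expm1 $ ?n"
      using x_over_expm1_eq_neg_sum[of ?n] False by (simp add: sum_distrib_left)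
    finally show ?thesis .
  qed
  with cuts show ?case by (cases k) auto
qed


section \<open>The generating series\<close>

lemma psi_chain:
  assumes "is_chain n T"
  shows "psi T = (\<Sum>k<n. monom ((fps_ln 1 ^ Suc k) $ n / fact (Suc k)) (Suc k))"
proof -
  from assms have "rooted_tree T" "card (verts T) = n" by (auto simp: is_chain_def)
  moreover obtain f where "T = path_graph f n" "inj_on f {..<n}"
    using is_chain_imp_path_graph[OF assms] .
  ultimately show ?thesis by (simp add: psi_cut_sum cut_sum_path_graph del: fact_Suc power_Suc)
qed

lemma psi_shrub:
  assumes "is_shrub n T"
  shows "smult (1 / fact n) (psi T) =
    (\<Sum>k\<le>n. monom (x_over_expm1 $ (n - k) / fact (Suc k)) (Suc k))"
proof -
  from assms have T: "rooted_tree T" "card (verts T) = Suc n" by (auto simp: is_shrub_def)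
  obtain r L where L: "T = star_graph r L" "finite L" "card L = n" "r \<notin> L"
    using is_shrub_imp_star_graph[OF assms] .
  have "cut_sum T k = fact n * x_over_expm1 $ (n - k)" if "k \<le> n" for k
    using cut_sum_star_graph[of r L k] T(1)[unfolded L(1)] L(2-4) that unfolding L(1) by simp
  then have "psi T = (\<Sum>k\<le>n. smult (fact n) (monom (x_over_expm1 $ (n - k) / fact (Suc k)) (Suc k)))"
    unfolding psi_cut_sum T(2) lessThan_Suc_atMost by (simp add: smult_monom del: fact_Suc)
  also have "\<dots> = smult (fact n) (\<Sum>k\<le>n. monom (x_over_expm1 $ (n - k) / fact (Suc k)) (Suc k))"
    by (rule poly_eqI) (simp add: coeff_sum sum_distrib_left del: fact_Suc)
  finally show ?thesis by simp
qed

lemma fps_lift_nth [simp]: "fps_lift f $ n = [:f $ n:]"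
  by (simp add: fps_lift_def)

lemma sum_const_poly: "(\<Sum>i\<in>A. [:f i:]) = [:\<Sum>i\<in>A. f i:]"
  by (induction A rule: infinite_finite_induct) auto

lemma fps_lift_mult: "fps_lift (f * g) = fps_lift f * fps_lift g"
  by (rule fps_ext) (simp add: fps_mult_nth sum_const_poly mult.commute)

lemma fps_lift_power: "fps_lift (f ^ k) = fps_lift f ^ k"
proof (induction k)
  case 0
  show ?case by (rule fps_ext) simp
qed (simp add: fps_lift_mult)

lemma tvar_power: "tvar ^ k = monom 1 k"
  by (simp add: monom_altdef)

lemma fps_Exp_tvar_ln_nth:
  "fps_Exp (fps_const tvar * fps_ln1p) $ n = (\<Sum>k\<le>n. monom ((fps_ln 1 ^ k) $ n / fact k) k)"
proof -
  have "((fps_const tvar * fps_ln1p) ^ k) $ n = monom ((fps_ln 1 ^ k) $ n) k" for k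
  proof -
    have "(fps_const tvar * fps_ln1p) ^ k = fps_const (tvar ^ k) * fps_lift (fps_ln 1 ^ k)"
      by (simp add: fps_ln1p_def power_mult_distrib fps_lift_power fps_const_power)
    then show ?thesis by (simp add: tvar_power smult_monom)
  qed
  then show ?thesis
    by (simp add: fps_Exp_def fps_compose_nth atLeast0AtMost smult_monom)
qed

lemma fps_exp_of_nat_compose_fps_ln:
  "fps_exp (of_nat m) oo fps_ln 1 = (1 + fps_X :: rat fps) ^ m"
proof -
  have "fps_exp (of_nat m) oo fps_ln (1::rat) = (fps_exp 1 oo fps_ln 1) ^ m"
    using fps_exp_power_mult[of "1::rat" m] by (simp add: fps_compose_power)
  then show ?thesis by (simp add: fps_exp_compose_fps_ln)
qed

lemma poly_eqI_of_nat:
  fixes p q :: "rat poly"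
  assumes "\<And>m. poly p (of_nat m) = poly q (of_nat m)"
  shows "p = q"
proof (rule ccontr)
  assume "p \<noteq> q"
  then have "finite {x. poly (p - q) x = 0}" by (intro poly_roots_finite) simp
  moreover have "range of_nat \<subseteq> {x. poly (p - q) x = 0}" using assms by auto
  ultimately have "finite (range (of_nat :: nat \<Rightarrow> rat))" by (rule rev_finite_subset)
  then show False using finite_imageD inj_of_nat infinite_UNIV_nat by blast
qed

text \<open>Two polynomials over the rationals agree as soon as they agree at all $t = m \in \<nat>$, and there the
  identity is $e^{m \ln(1+x)} = (e^{\ln(1+x)})^m = (1 + x)^m$.\<close>

lemma fps_Exp_tvar_ln: "fps_Exp (fps_const tvar * fps_ln1p) = fps_binom_series tvar"
proof (intro fps_ext poly_eqI_of_nat)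
  fix n m
  have "poly (fps_Exp (fps_const tvar * fps_ln1p) $ n) (of_nat m) =
      (fps_exp (of_nat m) oo fps_ln 1) $ n"
    unfolding fps_Exp_tvar_ln_nth
    by (simp add: poly_sum poly_monom fps_compose_nth atLeast0AtMost mult.commute)
  also have "\<dots> = of_nat m gchoose n"
    by (simp add: fps_exp_of_nat_compose_fps_ln flip: fps_binomial_of_nat)
  also have "\<dots> = poly (fps_binom_series tvar $ n) (of_nat m)"
    by (simp add: fps_binom_series_def binom_poly_def gbinomial_prod_rev poly_prod)
  finally show "poly (fps_Exp (fps_const tvar * fps_ln1p) $ n) (of_nat m) =
      poly (fps_binom_series tvar $ n) (of_nat m)" .
qed

lemma chain_series_eq:
  assumes "\<And>n. 1 \<le> n \<Longrightarrow> is_chain n (C n)"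
  shows "chain_series C = fps_Exp (fps_const tvar * fps_ln1p)"
proof (rule fps_ext)
  fix n
  show "chain_series C $ n = fps_Exp (fps_const tvar * fps_ln1p) $ n"
  proof (cases "n = 0")
    case True
    then show ?thesis by (simp add: chain_series_def fps_Exp_tvar_ln_nth monom_0)
  next
    case False
    then have "psi (C n) = (\<Sum>k<n. monom ((fps_ln 1 ^ Suc k) $ n / fact (Suc k)) (Suc k))"
      using assms by (intro psi_chain) auto
    with False show ?thesis
      by (simp add: chain_series_def fps_Exp_tvar_ln_nth sum.atMost_shift del: fact_Suc power_Suc)
  qed
qed

lemma fps_Exp_X_tvar_nth: "fps_Exp (fps_X * fps_const tvar) $ n = monom (1 / fact n) n"
proof -
  have "((fps_X * fps_const tvar) ^ i) $ n = (if i = n then monom 1 n else 0)" for i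
    by (simp add: power_mult_distrib fps_const_power fps_X_power_nth tvar_power)
  then show ?thesis
    by (simp add: fps_Exp_def fps_compose_nth smult_monom if_distrib[of "smult _"] cong: if_cong)
qed

text \<open>The factor \<open>x\<close> accounts for the shift between the two sides: in \<open>psi (S n)\<close>, the term with
  $t^{k+1}$ carries the coefficient of $x^{n-k}$ in $x/(e^x - 1)$, and these exponents add up to
  $n + 1$.\<close>

lemma shrub_series_mult_X:
  assumes "\<And>n. is_shrub n (S n)"
  shows "fps_X * shrub_series S = (fps_Exp (fps_X * fps_const tvar) - 1) * fps_lift x_over_expm1"
proof (rule fps_ext)
  fix n
  show "(fps_X * shrub_series S) $ n =
    ((fps_Exp (fps_X * fps_const tvar) - 1) * fps_lift x_over_expm1) $ n"
  proof (cases n)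
    case 0
    then show ?thesis by (simp add: fps_Exp_X_tvar_nth monom_0)
  next
    case (Suc m)
    have "((fps_Exp (fps_X * fps_const tvar) - 1) * fps_lift x_over_expm1) $ Suc m =
        (\<Sum>i\<le>m. monom (1 / fact (Suc i)) (Suc i) * [:x_over_expm1 $ (m - i):])"
      unfolding fps_mult_nth sum.atLeast0_atMost_Suc_shift
      by (simp add: fps_Exp_X_tvar_nth monom_0 atLeast0AtMost del: fact_Suc)
    then show ?thesis
      using psi_shrub[OF assms, of m] Suc
      by (simp add: shrub_series_def smult_monom del: fact_Suc)
  qed
qed

lemma x_over_expm1_fps_Exp_X: "fps_lift x_over_expm1 * (fps_Exp fps_X - 1) = fps_X"
proof -
  have "fps_Exp fps_X - 1 = fps_lift (fps_X * fps_shift 1 (fps_exp 1))"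
  proof (rule fps_ext)
    show "(fps_Exp fps_X - 1) $ n = fps_lift (fps_X * fps_shift 1 (fps_exp 1)) $ n" for n
      by (cases n) (simp_all add: fps_Exp_def one_pCons del: fact_Suc)
  qed
  then have "fps_lift x_over_expm1 * (fps_Exp fps_X - 1) =
      fps_lift (fps_X * (x_over_expm1 * fps_shift 1 (fps_exp 1)))"
    by (simp add: mult_ac flip: fps_lift_mult)
  also have "\<dots> = fps_X"
    unfolding x_over_expm1_mult by (rule fps_ext) (simp add: fps_X_def one_pCons)
  finally show ?thesis .
qed

lemma shrub_series_eq:
  assumes "\<And>n. is_shrub n (S n)"
  shows "shrub_series S * (fps_Exp fps_X - 1) = fps_Exp (fps_X * fps_const tvar) - 1"
proof -
  have "fps_X * (shrub_series S * (fps_Exp fps_X - 1)) =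
      (fps_Exp (fps_X * fps_const tvar) - 1) * (fps_lift x_over_expm1 * (fps_Exp fps_X - 1))"
    using shrub_series_mult_X[OF assms] by (simp only: mult.assoc[symmetric])
  also have "\<dots> = fps_X * (fps_Exp (fps_X * fps_const tvar) - 1)"
    by (simp only: x_over_expm1_fps_Exp_X mult.commute)
  finally show ?thesis by simp
qed

theorem corollary3p15:
  fixes C :: "nat \<Rightarrow> 'a rgraph" and S :: "nat \<Rightarrow> 'b rgraph"
  assumes "\<And>n. 1 \<le> n \<Longrightarrow> is_chain n (C n)"
    and "\<And>n. is_shrub n (S n)"
  shows "(chain_series C = fps_Exp (fps_const tvar * fps_ln1p) \<and>
          fps_Exp (fps_const tvar * fps_ln1p) = fps_binom_series tvar \<and>
          (\<forall>n\<ge>1. psi (C n) = binom_poly tvar n)) \<and>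
         Fract (shrub_series S) 1 =
           Fract (fps_Exp (fps_X * fps_const tvar) - 1) 1 / Fract (fps_Exp fps_X - 1) 1"
proof (intro conjI allI impI)
  show chain: "chain_series C = fps_Exp (fps_const tvar * fps_ln1p)"
    using assms(1) by (rule chain_series_eq)
  show "fps_Exp (fps_const tvar * fps_ln1p) = fps_binom_series tvar"
    by (rule fps_Exp_tvar_ln)
  show "psi (C n) = binom_poly tvar n" if "1 \<le> n" for n
    using arg_cong[OF chain, of "\<lambda>f. f $ n"] that
    by (simp add: fps_Exp_tvar_ln chain_series_def fps_binom_series_def)
  show "Fract (shrub_series S) 1 =
      Fract (fps_Exp (fps_X * fps_const tvar) - 1) 1 / Fract (fps_Exp fps_X - 1) 1"
    using shrub_series_eq[OF assms(2)] fps_Exp_X_minus_1_nonzero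
    by (simp add: eq_fract)
qed

end
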